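(* For $n\ge3$ with $n\equiv2\pmod4$, $$p_n(\Sigma^-_2)=C'(n,2)-C'(\tfrac n2,2)=L_2(n),$$ where $L_2(n)=\frac1n\sum_{d\mid n}\mu(d)2^{n/d}$ and $\mu$ is the Möbius function.
   Context: For $\sigma\in\{+,-\}^k$ ($k\ge2$), let $\mathcal W_k$ be the set of infinite words over $\{0,\dots,k-1\}$ with the linear order $\prec_\sigma$: for $s\neq t$, with $j$ the first index where $s_j\neq t_j$ and $c=|\{i<j:\sigma_{s_i}=-\}|$, $s\prec_\sigma t$ iff ($c$ even and $s_j<t_j$) or ($c$ odd and $s_j>t_j$). The signed shift $\Sigma_\sigma$ deletes the first letter of a word. Let $\mathcal W_{k,n}$ be the set of words $(s_1\dots s_n)^\infty$ with $s_1\dots s_n$ primitive (not a power of a shorter word). For $s\in\mathcal W_{k,n}$ let $\Pi_\sigma(s)\in\mathcal S_n$ be the permutation with $\Pi_\sigma(s)_i<\Pi_\sigma(s)_j$ iff $s_is_{i+1}\dots\prec_\sigma s_js_{j+1}\dots$. Let $\mathcal P_n(\Sigma_\sigma)=\{\Pi_\sigma(s):s\in\mathcal W_{k,n}\}$ and $p_n(\Sigma_\sigma)=|\mathcal P_n(\Sigma_\sigma)|/n$ (the number of classes of $\mathcal P_n(\Sigma_\sigma)$ under cyclic rotation). $\Sigma^-_k$ denotes the reverse $k$-shift $\Sigma_{-^k}$ (all signs $-$). $C'(n,i)$ denotes the number of cyclic permutations ($n$-cycles) in $\mathcal S_n$ with exactly $i-1$ ascents, an ascent of $\tau$ being an $i\in[n-1]$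 with $\tau_i<\tau_{i+1}$. *)

theory Defs
  imports
    Complex_Main
    "HOL-Library.Stream"
    "HOL-Combinatorics.Permutations"
    "HOL-Combinatorics.Orbits"
    "HOL-Computational_Algebra.Squarefree"
begin

datatype sign = Plus | Minus

text \<open>
  A sign vector in \<open>{+,-}^k\<close> is a list of signs of length \<open>k\<close>, entry \<open>\<sigma> ! a\<close> being the sign of
  the letter \<open>a < k\<close>.  Infinite words are streams, so the signed shift is \<^const>\<open>stl\<close>
  and \<open>s\<^sub>i s\<^sub>i\<^sub>+\<^sub>1 \<dots>\<close>, with letters numbered from 1, is \<open>sdrop (i - 1) s\<close>.
\<close>

definition word_less :: "sign list \<Rightarrow> nat stream \<Rightarrow> nat stream \<Rightarrow> bool" where
  "word_less \<sigma> s t \<longleftrightarrow>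
     (\<exists>j. (\<forall>i<j. s !! i = t !! i) \<and> s !! j \<noteq> t !! j \<and>
          (let c = card {i. i < j \<and> \<sigma> ! (s !! i) = Minus}
           in (even c \<and> s !! j < t !! j) \<or> (odd c \<and> s !! j > t !! j)))"

definition primitive_word :: "'a list \<Rightarrow> bool" where
  "primitive_word u \<longleftrightarrow>
     u \<noteq> [] \<and> \<not> (\<exists>v m. length v < length u \<and> u = concat (replicate m v))"

definition periodic_words :: "nat \<Rightarrow> nat \<Rightarrow> nat stream set" where
  "periodic_words k n =
     {cycle u | u. length u = n \<and> set u \<subseteq> {..<k} \<and> primitive_word u}"

definition pattern_perm :: "sign list \<Rightarrow> nat \<Rightarrow> nat stream \<Rightarrow> nat \<Rightarrow> nat" where
  "pattern_perm \<sigma> n s =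
     (THE \<pi>. \<pi> permutes {1..n} \<and>
        (\<forall>i\<in>{1..n}. \<forall>j\<in>{1..n}.
           \<pi> i < \<pi> j \<longleftrightarrow> word_less \<sigma> (sdrop (i - 1) s) (sdrop (j - 1) s)))"

definition periodic_patterns :: "sign list \<Rightarrow> nat \<Rightarrow> (nat \<Rightarrow> nat) set" where
  "periodic_patterns \<sigma> n = pattern_perm \<sigma> n ` periodic_words (length \<sigma>) n"

definition num_periodic_patterns :: "sign list \<Rightarrow> nat \<Rightarrow> real" where
  "num_periodic_patterns \<sigma> n = real (card (periodic_patterns \<sigma> n)) / real n"

definition reverse_shift :: "nat \<Rightarrow> sign list" where
  "reverse_shift k = replicate k Minus"

definition ascents :: "nat \<Rightarrow> (nat \<Rightarrow> nat) \<Rightarrow> nat set" where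
  "ascents n \<tau> = {i\<in>{1..n-1}. \<tau> i < \<tau> (i + 1)}"

definition num_cyclic_ascents :: "nat \<Rightarrow> nat \<Rightarrow> nat" where
  "num_cyclic_ascents n i =
     card {\<tau>. \<tau> permutes {1..n} \<and> cyclic_on \<tau> {1..n} \<and> card (ascents n \<tau>) + 1 = i}"

definition moebius :: "nat \<Rightarrow> int" where
  "moebius d = (if squarefree d then (-1) ^ card (prime_factors d) else 0)"

definition L_count :: "nat \<Rightarrow> nat \<Rightarrow> real" where
  "L_count k n =
     1 / real n * (\<Sum>d | d dvd n. real_of_int (moebius d) * real k ^ (n div d))"

end

theory Submission
  imports Defs
begin

text \<open>
  Reading the ranks of the shifts of a periodic binary word along the shift gives a cyclic sequence
  \<open>\<pi>\<close>, and the cycle \<open>\<tau>\<close> with \<open>\<tau> (\<pi> i) = \<pi> (i + 1)\<close> is decreasing on the ranks of the words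
  starting with 0 and on those of the words starting with 1. For \<open>n \<ge> 3\<close> an \<open>n\<close>-cycle is not decreasing,
  so it has exactly one ascent, which separates the two blocks, and \<open>\<pi>\<close> determines the word. Hence
  the number of patterns is the number of primitive words, which Moebius inversion evaluates.

  Conversely, an \<open>n\<close>-cycle with one ascent and a starting point determine a binary word of period
  \<open>n\<close>. If its minimal period is \<open>p\<close>, then \<open>\<tau> ^ p\<close> permutes the ranks of equal words cyclically
  and is monotone on them, increasing for even \<open>p\<close> and decreasing for odd \<open>p\<close>; so \<open>p = n\<close>, or
  \<open>n = 2 * p\<close> with \<open>p\<close> odd. A word of the first kind arises once, one of the second kind twice.
  Counting for \<open>n\<close> and for the odd number \<open>n div 2\<close> gives the formula.
\<close>

section \<open>Moebius inversion\<close>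

lemma prime_factors_prod_primes:
  fixes X :: "nat set"
  assumes "finite X" "\<And>p. p \<in> X \<Longrightarrow> prime p"
  shows "prime_factors (\<Prod>X) = X"
proof (rule set_eqI)
  fix p
  have nz: "\<Prod>X \<noteq> 0" using assms(1) assms(2)[of 0] by auto
  show "p \<in> prime_factors (\<Prod>X) \<longleftrightarrow> p \<in> X"
  proof
    assume "p \<in> prime_factors (\<Prod>X)"
    then have p: "prime p" "p dvd \<Prod>X" by auto
    then obtain q where q: "q \<in> X" "p dvd q"
      using prime_dvd_prod_iff[OF assms(1) p(1), of "\<lambda>x. x"] by auto
    then show "p \<in> X" using assms(2) p(1) primes_dvd_imp_eq by blast
  next
    assume "p \<in> X"
    then show "p \<in> prime_factors (\<Prod>X)"
      using assms nz by (auto simp: prime_factors_dvd intro: dvd_prodI[OF assms(1), of p "\<lambda>x. x", simplified])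
  qed
qed

lemma squarefree_prod_primes:
  fixes X :: "nat set"
  assumes "finite X" "\<And>p. p \<in> X \<Longrightarrow> prime p"
  shows "squarefree (\<Prod>X)"
  using assms
  by (intro squarefree_prod_coprime) (simp_all add: primes_coprime squarefree_prime)

lemma prod_prime_factors_squarefree:
  fixes d :: nat
  assumes "squarefree d"
  shows "\<Prod>(prime_factors d) = d"
proof -
  have d: "d \<noteq> 0" using assms by (metis not_squarefree_0)
  have "(\<Prod>p\<in>prime_factors d. p) = (\<Prod>p\<in>prime_factors d. p ^ multiplicity p d)"
  proof (rule prod.cong)
    fix p assume p: "p \<in> prime_factors d"
    then have "multiplicity p d \<le> 1"
      using assms d squarefree_factorial_semiring''[of d] by auto
    moreover have "multiplicity p d > 0" using p by (simp add: prime_factors_multiplicity)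
    ultimately have "multiplicity p d = 1" by linarith
    then show "p = p ^ multiplicity p d" by simp
  qed simp
  also have "\<dots> = d" using prod_prime_factors[OF d] by simp
  finally show ?thesis by simp
qed

text \<open>Only squarefree divisors contribute, and taking prime factors matches them with the
  subsets of \<open>prime_factors n\<close>. The alternating sum over these subsets is the expansion
  of a product of factors \<open>1 - 1\<close>, which is nonzero only when the product is
  empty.\<close>

lemma sum_moebius_divisors:
  assumes "n > 0"
  shows "(\<Sum>d | d dvd n. moebius d) = (if n = 1 then 1 else 0)"
proof -
  have fin: "finite {d. d dvd n}" using assms by simp
  have "(\<Sum>d | d dvd n. moebius d)
      = (\<Sum>d | d dvd n \<and> squarefree d. (-1) ^ card (prime_factors d))"
    using fin by (intro sum.mono_neutral_cong_right) (auto simp: moebius_def)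
  also have "\<dots> = (\<Sum>X\<in>Pow (prime_factors n). (-1) ^ card X)"
  proof (rule sum.reindex_bij_witness[where i = "\<lambda>X. \<Prod>X" and j = prime_factors])
    fix X assume X: "X \<in> Pow (prime_factors n)"
    then have fX: "finite X" and pX: "\<And>p. p \<in> X \<Longrightarrow> prime p"
      by (auto intro: finite_subset)
    show "prime_factors (\<Prod>X) = X" by (rule prime_factors_prod_primes[OF fX pX])
    have "\<Prod>X dvd \<Prod>(prime_factors n)"
      using X by (intro prod_dvd_prod_subset) auto
    also have "\<dots> dvd (\<Prod>p\<in>prime_factors n. p ^ multiplicity p n)"
      using assms by (intro prod_dvd_prod) (auto simp: prime_factors_multiplicity)
    also have "\<dots> = n" using prod_prime_factors[of n] assms by simp
    finally show "\<Prod>X \<in> {d. d dvd n \<and> squarefree d}"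
      using squarefree_prod_primes[OF fX pX] by simp
  qed (use assms in \<open>auto simp: prod_prime_factors_squarefree intro: dvd_prime_factors[THEN subsetD]\<close>)
  also have "\<dots> = (\<Prod>p\<in>prime_factors n. 1 - 1)"
    using prod_diff_conv_sum[of "prime_factors n" "\<lambda>_. 1::int" "\<lambda>_. 1"] by simp
  also have "\<dots> = (if n = 1 then 1 else 0)"
    using assms by (auto simp: prime_factorization_empty_iff card_gt_0_iff)
  finally show ?thesis .
qed

text \<open>Both sums run over the pairs with \<open>d * e dvd n\<close>. After exchanging them, the
  inner sum over the divisors of \<open>n div e\<close> vanishes unless
  \<open>e = n\<close>.\<close>

lemma moebius_inversion:
  fixes f g :: "nat \<Rightarrow> real"
  assumes "n > 0" and "\<And>m. m > 0 \<Longrightarrow> f m = (\<Sum>e | e dvd m. g e)"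
  shows "(\<Sum>d | d dvd n. real_of_int (moebius d) * f (n div d)) = g n"
proof -
  have fin: "finite {d. d dvd n}" using assms by simp
  have "(\<Sum>d | d dvd n. real_of_int (moebius d) * f (n div d))
      = (\<Sum>d\<in>{d. d dvd n}. \<Sum>e\<in>{e \<in> {e. e dvd n}. d * e dvd n}. real_of_int (moebius d) * g e)"
  proof (rule sum.cong)
    fix d assume "d \<in> {d. d dvd n}"
    then have d: "d dvd n" "d > 0" "n div d > 0"
      using assms(1) by (auto simp: dvd_pos_nat div_greater_zero_iff dvd_imp_le)
    then have "{e. e dvd n div d} = {e \<in> {e. e dvd n}. d * e dvd n}"
      by (auto simp: dvd_div_iff_mult mult.commute intro: dvd_mult_right)
    then show "real_of_int (moebius d) * f (n div d)
      = (\<Sum>e\<in>{e \<in> {e. e dvd n}. d * e dvd n}. real_of_int (moebius d) * g e)"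
      using assms(2)[OF d(3)] by (simp add: sum_distrib_left)
  qed simp
  also have "\<dots> = (\<Sum>e\<in>{e. e dvd n}. \<Sum>d\<in>{d \<in> {d. d dvd n}. d * e dvd n}. real_of_int (moebius d) * g e)"
    by (rule sum.swap_restrict[OF fin fin])
  also have "\<dots> = (\<Sum>e\<in>{e. e dvd n}. if e = n then g e else 0)"
  proof (rule sum.cong)
    fix e assume "e \<in> {e. e dvd n}"
    then have e: "e dvd n" "e > 0" "n div e > 0"
      using assms(1) by (auto simp: dvd_pos_nat div_greater_zero_iff dvd_imp_le)
    then have "{d \<in> {d. d dvd n}. d * e dvd n} = {d. d dvd n div e}"
      by (auto simp: dvd_div_iff_mult intro: dvd_mult_left)
    then have "(\<Sum>d\<in>{d \<in> {d. d dvd n}. d * e dvd n}. real_of_int (moebius d) * g e)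
      = real_of_int (\<Sum>d | d dvd n div e. moebius d) * g e"
      by (simp add: sum_distrib_right)
    also have "\<dots> = (if e = n then g e else 0)"
      using e sum_moebius_divisors[OF e(3)] by (auto simp: dvd_div_eq_mult)
    finally show "(\<Sum>d\<in>{d \<in> {d. d dvd n}. d * e dvd n}. real_of_int (moebius d) * g e)
      = (if e = n then g e else 0)" .
  qed simp
  also have "\<dots> = g n" using fin by simp
  finally show ?thesis .
qed

section \<open>Periodic streams\<close>

definition periodic_streams :: "nat \<Rightarrow> nat \<Rightarrow> nat stream set" where
  "periodic_streams k n = {s. sset s \<subseteq> {..<k} \<and> sdrop n s = s}"

text \<open>Primitivity in terms of the minimal period, which is easier to handle than powers of
  words. The conjunct \<open>n > 0\<close> makes the set empty for \<open>n = 0\<close>, so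
  finiteness holds for every \<open>n\<close>.\<close>

definition primitive_streams :: "nat \<Rightarrow> nat \<Rightarrow> nat stream set" where
  "primitive_streams k n =
     {s \<in> periodic_streams k n. n > 0 \<and> (\<forall>m. 0 < m \<and> m < n \<longrightarrow> sdrop m s \<noteq> s)}"

lemma sdrop_mult_period: "sdrop p s = s \<Longrightarrow> sdrop (q * p) s = s"
  by (induction q) (simp_all add: sdrop_add[symmetric] del: sdrop_add)

lemma sdrop_mod_period: "sdrop p s = s \<Longrightarrow> sdrop (m mod p) s = sdrop m s"
  using sdrop_add[of "m mod p" "m div p * p" s] by (simp add: sdrop_mult_period del: sdrop_add)

lemma stream_eq_snthI: "(\<And>i. s !! i = t !! i) \<Longrightarrow> s = t"
  by (metis ext stream_smap_nats)

lemma stream_eq_cycle_stake: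
  assumes "sdrop n s = s" "n > 0"
  shows "s = cycle (stake n s)"
proof -
  have ne: "stake n s \<noteq> []" using assms by simp
  have "s !! i = cycle (stake n s) !! i" for i
  proof -
    have snth_mod: "t !! i = t !! (i mod n)" if "sdrop n t = t" for t :: "'a stream"
      using sdrop_mod_period[OF that, of i] by (metis sdrop_simps(1))
    have "sdrop n (cycle (stake n s)) = cycle (stake n s)"
      using sdrop_cycle_eq[OF ne] by simp
    then have "cycle (stake n s) !! i = cycle (stake n s) !! (i mod n)" by (rule snth_mod)
    also have "\<dots> = stake n (cycle (stake n s)) ! (i mod n)"
      using assms(2) by (intro stake_nth[symmetric]) simp
    also have "stake n (cycle (stake n s)) = stake n s"
      using stake_cycle_eq[OF ne] by simp
    also have "stake n s ! (i mod n) = s !! (i mod n)" using assms(2) by simp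
    finally show ?thesis using snth_mod[OF assms(1)] by simp
  qed
  then show ?thesis by (rule stream_eq_snthI)
qed

lemma periodic_streams_eq_cycle:
  assumes "n > 0"
  shows "periodic_streams k n = cycle ` {u. set u \<subseteq> {..<k} \<and> length u = n}"
proof (intro equalityI subsetI)
  fix s assume s: "s \<in> periodic_streams k n"
  have "set (stake n s) \<subseteq> {..<k}"
    using s by (fastforce simp: periodic_streams_def sset_range in_set_conv_nth)
  with s stream_eq_cycle_stake[of n s] assms
  show "s \<in> cycle ` {u. set u \<subseteq> {..<k} \<and> length u = n}"
    by (auto simp: periodic_streams_def)
next
  fix s assume "s \<in> cycle ` {u. set u \<subseteq> {..<k} \<and> length u = n}"
  then obtain u where "s = cycle u" "set u \<subseteq> {..<k}" "length u = n" by auto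
  moreover from this have "u \<noteq> []" using assms by auto
  ultimately show "s \<in> periodic_streams k n"
    using sdrop_cycle_eq[of u] by (auto simp: periodic_streams_def)
qed

lemma inj_on_cycle: "inj_on cycle {u. P u \<and> length u = n}"
proof (cases "n = 0")
  case False
  show ?thesis
  proof (rule inj_onI)
    fix u v assume "u \<in> {u. P u \<and> length u = n}" "v \<in> {u. P u \<and> length u = n}" "cycle u = cycle v"
    with False show "u = v" using stake_cycle_eq[of u] stake_cycle_eq[of v] by force
  qed
qed (auto simp: inj_on_def)

lemma card_periodic_streams:
  assumes "n > 0"
  shows "card (periodic_streams k n) = k ^ n"
  using card_lists_length_eq[of "{..<k}" n]
  by (simp add: periodic_streams_eq_cycle[OF assms] card_image[OF inj_on_cycle])

lemma finite_periodic_streams: "n > 0 \<Longrightarrow> finite (periodic_streams k n)"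
  using finite_lists_length_eq[of "{..<k}" n] by (simp add: periodic_streams_eq_cycle)

text \<open>Otherwise the remainder \<open>m mod p\<close> would be a positive period below the
  minimal one.\<close>

lemma primitive_streams_dvd:
  assumes "s \<in> primitive_streams k p" "sdrop m s = s"
  shows "p dvd m"
proof -
  have p: "sdrop p s = s" "p > 0" and min: "\<And>m. 0 < m \<Longrightarrow> m < p \<Longrightarrow> sdrop m s \<noteq> s"
    using assms(1) by (simp_all add: primitive_streams_def periodic_streams_def)
  have "sdrop (m mod p) s = s"
    using sdrop_mod_period[OF p(1)] assms(2) by simp
  with min[of "m mod p"] p(2) have "m mod p = 0" by (metis mod_less_divisor neq0_conv)
  then show ?thesis by (simp add: dvd_eq_mod_eq_0)
qed

lemma periodic_streams_eq_Union:
  assumes "n > 0"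
  shows "periodic_streams k n = (\<Union>d\<in>{d. d dvd n}. primitive_streams k d)"
proof (intro equalityI subsetI)
  fix s assume s: "s \<in> periodic_streams k n"
  define d where "d = (LEAST d. 0 < d \<and> sdrop d s = s)"
  have ex: "0 < n \<and> sdrop n s = s" using s assms by (auto simp: periodic_streams_def)
  have "0 < d \<and> sdrop d s = s" unfolding d_def by (rule LeastI[of _ n]) (fact ex)
  moreover have "\<forall>m. 0 < m \<and> m < d \<longrightarrow> sdrop m s \<noteq> s"
    unfolding d_def using not_less_Least by blast
  ultimately have "s \<in> primitive_streams k d"
    using s by (auto simp: primitive_streams_def periodic_streams_def)
  moreover from this ex have "d dvd n" by (blast intro: primitive_streams_dvd)
  ultimately show "s \<in> (\<Union>d\<in>{d. d dvd n}. primitive_streams k d)" by blast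
next
  fix s assume "s \<in> (\<Union>d\<in>{d. d dvd n}. primitive_streams k d)"
  then obtain d q where "n = q * d" "s \<in> primitive_streams k d"
    by (auto elim!: dvdE simp: mult.commute)
  then show "s \<in> periodic_streams k n"
    by (auto simp: primitive_streams_def periodic_streams_def sdrop_mult_period)
qed

lemma disjoint_primitive_streams:
  assumes "d \<noteq> e"
  shows "primitive_streams k d \<inter> primitive_streams k e = {}"
proof (rule ccontr)
  assume "primitive_streams k d \<inter> primitive_streams k e \<noteq> {}"
  then obtain s where s: "s \<in> primitive_streams k d" "s \<in> primitive_streams k e" by blast
  then have "sdrop d s = s" "sdrop e s = s"
    by (auto simp: primitive_streams_def periodic_streams_def)
  with s have "d dvd e" "e dvd d" by (blast intro: primitive_streams_dvd)+
  with assms show False by (blast dest: dvd_antisym)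
qed

lemma finite_primitive_streams: "finite (primitive_streams k n)"
proof (cases "n > 0")
  case True
  show ?thesis by (rule finite_subset[OF _ finite_periodic_streams[OF True]]) (auto simp: primitive_streams_def)
qed (simp add: primitive_streams_def)

text \<open>Sorting the \<open>k ^ m\<close> streams of period \<open>m\<close> by their minimal
  period, a divisor of \<open>m\<close>, gives the divisor sum to be inverted.\<close>

lemma card_primitive_streams:
  assumes "n > 0"
  shows "real (card (primitive_streams k n)) = real n * L_count k n"
proof -
  have "real k ^ m = (\<Sum>e | e dvd m. real (card (primitive_streams k e)))" if "m > 0" for m
  proof -
    have "k ^ m = card (\<Union>d\<in>{d. d dvd m}. primitive_streams k d)"
      using card_periodic_streams[OF that, of k] periodic_streams_eq_Union[OF that] by simp
    also have "\<dots> = (\<Sum>e | e dvd m. card (primitive_streams k e))"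
      using that by (intro card_UN_disjoint) (auto simp: finite_primitive_streams disjoint_primitive_streams)
    finally show ?thesis by (metis of_nat_power of_nat_sum)
  qed
  from moebius_inversion[OF assms this] show ?thesis
    using assms by (simp add: L_count_def)
qed

text \<open>If the minimal period \<open>d\<close> of \<open>cycle u\<close> is below
  \<open>n\<close>, then \<open>u\<close> is a power of its first \<open>d\<close> letters.
  Conversely, if \<open>u\<close> is a power of a shorter word \<open>v\<close>, then
  \<open>length v\<close> is a smaller period of \<open>cycle u\<close>.\<close>

lemma periodic_words_eq_primitive_streams:
  assumes "n > 0"
  shows "periodic_words k n = primitive_streams k n"
proof (intro equalityI subsetI)
  fix s assume "s \<in> periodic_words k n"
  then obtain u where u: "s = cycle u" "length u = n" "set u \<subseteq> {..<k}" "primitive_word u"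
    by (auto simp: periodic_words_def)
  have "s \<in> periodic_streams k n"
    using u assms by (auto simp: periodic_streams_eq_cycle)
  then obtain d where d: "d dvd n" "s \<in> primitive_streams k d"
    using periodic_streams_eq_Union[OF assms] by auto
  define v where "v = stake d s"
  have d': "d > 0" "sdrop d s = s" "length v = d" "v \<noteq> []"
    using d by (auto simp: primitive_streams_def periodic_streams_def v_def)
  have "u = stake n s" using u assms stake_cycle_eq[of u] by auto
  also have "\<dots> = stake n (cycle v)"
    using stream_eq_cycle_stake[OF d'(2,1)] unfolding v_def by (rule arg_cong)
  also have "\<dots> = concat (replicate (n div d) v)"
    using d d' by simp
  finally have "\<not> length v < length u" using u(4) by (auto simp: primitive_word_def)
  then have "d = n" using d d' u(2) dvd_imp_le[OF d(1) assms] by simp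
  then show "s \<in> primitive_streams k n" using d by simp
next
  fix s assume s: "s \<in> primitive_streams k n"
  then have "s \<in> periodic_streams k n" by (simp add: primitive_streams_def)
  then obtain u where u: "s = cycle u" "length u = n" "set u \<subseteq> {..<k}"
    using assms by (auto simp: periodic_streams_eq_cycle)
  have "\<not> length v < length u" if uv: "u = concat (replicate m v)" for m v
  proof
    assume less: "length v < length u"
    have v: "v \<noteq> []" using uv u(2) assms by (cases v) auto
    have n: "n = m * length v" using uv u(2) by (simp add: length_concat sum_list_replicate)
    have "u = stake n (cycle v)" using v n uv by simp
    moreover have "sdrop n (cycle v) = cycle v" using v n by simp
    ultimately have "cycle v = s" using stream_eq_cycle_stake[of n "cycle v"] assms u(1) by metis
    then have "sdrop (length v) s = s" using sdrop_cycle_eq[OF v] by simp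
    then show False using s less v u(2) by (auto simp: primitive_streams_def)
  qed
  then have "primitive_word u" using u(2) assms by (auto simp: primitive_word_def)
  then show "s \<in> periodic_words k n" using u by (auto simp: periodic_words_def)
qed

section \<open>The alternating order\<close>

definition alt_less :: "'a::linorder stream \<Rightarrow> 'a stream \<Rightarrow> bool" where
  "alt_less s t \<longleftrightarrow>
     (\<exists>j. (\<forall>i<j. s !! i = t !! i) \<and> (if even j then s !! j < t !! j else t !! j < s !! j))"

text \<open>When all signs are minus, every position before \<open>j\<close> counts, so
  \<open>c = j\<close> and the direction of the comparison depends on the parity of the first
  differing position.\<close>

lemma word_less_reverse_shift:
  assumes "sset s \<subseteq> {..<k}"
  shows "word_less (reverse_shift k) s t \<longleftrightarrow> alt_less s t"
proof -
  have "s !! i < k" for i using assms by (auto simp: sset_range)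
  then have "{i. i < j \<and> reverse_shift k ! (s !! i) = Minus} = {..<j}" for j
    by (auto simp: reverse_shift_def)
  then show ?thesis by (auto simp: word_less_def alt_less_def Let_def split: if_splits)
qed

lemma not_alt_less_refl: "\<not> alt_less s s"
  by (auto simp: alt_less_def)

lemma alt_less_linear:
  assumes "s \<noteq> t"
  shows "alt_less s t \<or> alt_less t s"
proof -
  have ex: "\<exists>j. s !! j \<noteq> t !! j" using assms stream_eq_snthI by blast
  define j where "j = (LEAST j. s !! j \<noteq> t !! j)"
  have "s !! j \<noteq> t !! j" unfolding j_def using ex by (rule LeastI_ex)
  moreover have "\<forall>i<j. s !! i = t !! i" unfolding j_def using not_less_Least by blast
  ultimately show ?thesis by (auto simp: alt_less_def intro!: exI[of _ j])
qed

text \<open>The two outer words first differ at the smaller of the two given positions, or at the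
  common one.\<close>

lemma alt_less_trans:
  assumes "alt_less s t" "alt_less t u"
  shows "alt_less s u"
proof -
  obtain j where j: "\<forall>i<j. s !! i = t !! i" "if even j then s !! j < t !! j else t !! j < s !! j"
    using assms(1) by (auto simp: alt_less_def)
  obtain l where l: "\<forall>i<l. t !! i = u !! i" "if even l then t !! l < u !! l else u !! l < t !! l"
    using assms(2) by (auto simp: alt_less_def)
  have eq: "\<forall>i<min j l. s !! i = u !! i" using j(1) l(1) by simp
  have "if even (min j l) then s !! min j l < u !! min j l else u !! min j l < s !! min j l"
  proof (cases j l rule: linorder_cases)
    case less
    then show ?thesis using j(2) l(1) by (auto simp: min_def)
  next
    case equal
    then show ?thesis using j(2) l(2) by (auto split: if_splits)
  next
    case greater
    then show ?thesis using j(1) l(2) by (auto simp: min_def)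
  qed
  with eq show ?thesis unfolding alt_less_def by blast
qed

text \<open>Deleting an equal first letter moves the first difference by one place, which changes
  its parity and so reverses the order. \<open>compatible\<close> imitates this rule.\<close>

lemma alt_less_stl:
  assumes "alt_less s t"
  shows "shd s < shd t \<or> shd s = shd t \<and> alt_less (stl t) (stl s)"
proof -
  obtain j where j: "\<forall>i<j. s !! i = t !! i" "if even j then s !! j < t !! j else t !! j < s !! j"
    using assms by (auto simp: alt_less_def)
  show ?thesis
  proof (cases j)
    case 0
    then show ?thesis using j by simp
  next
    case (Suc l)
    then have "shd s = shd t" using j(1) by force
    moreover have "\<forall>i<l. stl t !! i = stl s !! i" using j(1) Suc by force
    moreover have "if even l then stl t !! l < stl s !! l else stl s !! l < stl t !! l"
      using j(2) Suc by (auto split: if_splits)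
    ultimately show ?thesis unfolding alt_less_def by blast
  qed
qed

lemma primitive_streams_sdrop_eq_iff:
  assumes "s \<in> primitive_streams k p"
  shows "sdrop i s = sdrop j s \<longleftrightarrow> i mod p = j mod p"
proof
  have p: "sdrop p s = s" "p > 0"
    using assms by (simp_all add: primitive_streams_def periodic_streams_def)
  show "sdrop i s = sdrop j s" if "i mod p = j mod p"
    using that sdrop_mod_period[OF p(1), of i] sdrop_mod_period[OF p(1), of j] by simp
  have le: "a = b" if "a \<le> b" "b < p" "sdrop a s = sdrop b s" for a b
  proof -
    \<comment> \<open>Dropping \<open>p - a\<close> further letters turns the left side back into
      \<open>s\<close>, so that \<open>(b - a) + p\<close> is a period.\<close>
    have "sdrop (a + (p - a)) s = sdrop (b + (p - a)) s"
      using that(3) by (simp only: sdrop_add[symmetric])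
    then have "sdrop ((b - a) + p) s = s" using that p(1) by simp
    then have "p dvd (b - a) + p" by (rule primitive_streams_dvd[OF assms])
    then have "p dvd b - a" by simp
    then show ?thesis using that by (metis diff_is_0_eq dvd_imp_le le_antisym less_imp_diff_less not_gr_zero not_less)
  qed
  show "i mod p = j mod p" if "sdrop i s = sdrop j s"
  proof -
    have "sdrop (i mod p) s = sdrop (j mod p) s"
      using that p(1) by (simp add: sdrop_mod_period)
    then show ?thesis
      using le[of "i mod p" "j mod p"] le[of "j mod p" "i mod p"] p(2)
      by (metis linear mod_less_divisor)
  qed
qed

section \<open>Rankings compatible with a stream\<close>

text \<open>\<open>\<pi> i\<close> stands for the rank of the word starting at position
  \<open>i\<close>, counted from 0. The periodic extension to all positions allows shifting without
  reduction modulo \<open>n\<close>.\<close>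

definition ranking :: "nat \<Rightarrow> (nat \<Rightarrow> nat) \<Rightarrow> bool" where
  "ranking n \<pi> \<longleftrightarrow> (\<forall>i. \<pi> (i + n) = \<pi> i) \<and> bij_betw \<pi> {..<n} {1..n}"

text \<open>A one-step version of the alternating order. Equal words at different positions may
  receive different ranks, as long as these ties reverse at each shift; this freedom accommodates
  cycles whose word has a shorter period.\<close>

definition compatible :: "(nat \<Rightarrow> nat) \<Rightarrow> 'a::linorder stream \<Rightarrow> bool" where
  "compatible \<pi> s \<longleftrightarrow>
     (\<forall>i j. \<pi> i < \<pi> j \<longrightarrow> s !! i < s !! j \<or> s !! i = s !! j \<and> \<pi> (Suc j) < \<pi> (Suc i))"

lemma ranking_mod:
  assumes "ranking n \<pi>"
  shows "\<pi> (i mod n) = \<pi> i"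
proof -
  have "\<pi> (r + q * n) = \<pi> r" for r q
    using assms by (induction q) (auto simp: ranking_def add.assoc[symmetric] add.commute[of n])
  from this[of "i mod n" "i div n"] show ?thesis by simp
qed

lemma ranking_eq_iff:
  assumes "ranking n \<pi>" "n > 0"
  shows "\<pi> i = \<pi> j \<longleftrightarrow> i mod n = j mod n"
proof -
  have "inj_on \<pi> {..<n}" using assms by (auto simp: ranking_def bij_betw_def)
  then have "\<pi> (i mod n) = \<pi> (j mod n) \<longleftrightarrow> i mod n = j mod n"
    using assms(2) by (auto simp: inj_on_eq_iff)
  then show ?thesis using ranking_mod[OF assms(1)] by simp
qed

lemma ranking_in_range:
  assumes "ranking n \<pi>" "n > 0"
  shows "\<pi> i \<in> {1..n}"
proof -
  have "\<pi> (i mod n) \<in> {1..n}" using assms by (auto simp: ranking_def bij_betw_def)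
  then show ?thesis using ranking_mod[OF assms(1)] by simp
qed

lemma ranking_surj:
  assumes "ranking n \<pi>" "y \<in> {1..n}"
  obtains i where "i < n" "\<pi> i = y"
  using assms unfolding ranking_def bij_betw_def by (metis imageE lessThan_iff)

lemma ranking_eq_card:
  assumes "ranking n \<pi>" "n > 0"
  shows "\<pi> i = Suc (card {j \<in> {..<n}. \<pi> j < \<pi> i})"
proof -
  have "\<pi> ` {j \<in> {..<n}. \<pi> j < \<pi> i} = {1..<\<pi> i}"
  proof (intro equalityI subsetI)
    fix y assume y: "y \<in> {1..<\<pi> i}"
    then have "y \<in> {1..n}" using ranking_in_range[OF assms, of i] by auto
    then obtain j where "j < n" "\<pi> j = y" by (rule ranking_surj[OF assms(1)])
    then show "y \<in> \<pi> ` {j \<in> {..<n}. \<pi> j < \<pi> i}" using y by auto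
  qed (use ranking_in_range[OF assms] in auto)
  moreover have "inj_on \<pi> {j \<in> {..<n}. \<pi> j < \<pi> i}"
    using assms by (auto simp: ranking_def bij_betw_def inj_on_def)
  ultimately have "card {j \<in> {..<n}. \<pi> j < \<pi> i} = card {1..<\<pi> i}"
    by (metis card_image)
  then show ?thesis using ranking_in_range[OF assms, of i] by simp
qed

lemma ranking_unique:
  assumes "ranking n \<pi>" "ranking n \<rho>" "n > 0"
    and "\<And>i j. \<pi> i < \<pi> j \<longleftrightarrow> \<rho> i < \<rho> j"
  shows "\<pi> = \<rho>"
proof
  fix i
  show "\<pi> i = \<rho> i"
    using ranking_eq_card[OF assms(1,3), of i] ranking_eq_card[OF assms(2,3), of i] assms(4) by simp
qed

text \<open>The assumptions make \<open>R\<close> a strict linear order on the residues modulo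
  \<open>n\<close>; the rank of a position is one more than the number of its predecessors within a
  period.\<close>

lemma ranking_exists:
  assumes "n > 0"
    and irrefl: "\<And>i. \<not> R i i"
    and trans: "\<And>i j l. R i j \<Longrightarrow> R j l \<Longrightarrow> R i l"
    and total: "\<And>i j. i mod n \<noteq> j mod n \<Longrightarrow> R i j \<or> R j i"
    and periodic: "\<And>i j. R (i mod n) (j mod n) \<longleftrightarrow> R i j"
  shows "\<exists>\<pi>. ranking n \<pi> \<and> (\<forall>i j. \<pi> i < \<pi> j \<longleftrightarrow> R i j)"
proof -
  define \<pi> where "\<pi> i = Suc (card {l \<in> {..<n}. R l i})" for i
  have mod: "\<pi> (i mod n) = \<pi> i" for i
    unfolding \<pi>_def using periodic by (metis mod_mod_trivial)
  have mono: "\<pi> i < \<pi> j" if "R i j" for i j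
  proof -
    have "i mod n \<in> {l \<in> {..<n}. R l j}" "i mod n \<notin> {l \<in> {..<n}. R l i}"
      using that periodic[of "i mod n" j] periodic[of i j] periodic[of "i mod n" i]
        periodic[of i i] irrefl assms(1) by auto
    moreover have "{l \<in> {..<n}. R l i} \<subseteq> {l \<in> {..<n}. R l j}"
      using trans[OF _ that] by auto
    ultimately have "{l \<in> {..<n}. R l i} \<subset> {l \<in> {..<n}. R l j}" by blast
    then show ?thesis unfolding \<pi>_def by (simp add: psubset_card_mono)
  qed
  have iff: "\<pi> i < \<pi> j \<longleftrightarrow> R i j" for i j
  proof
    assume less: "\<pi> i < \<pi> j"
    then have "i mod n \<noteq> j mod n" using mod by (metis less_irrefl)
    then show "R i j" using total mono less by (metis less_asym)
  qed (rule mono)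
  have "inj_on \<pi> {..<n}"
    using total iff by (intro inj_onI) (metis lessThan_iff less_irrefl mod_less)
  moreover have "\<pi> ` {..<n} \<subseteq> {1..n}"
  proof (intro image_subsetI)
    fix i assume i: "i \<in> {..<n}"
    have "card {l \<in> {..<n}. R l i} < card {..<n}"
      using i irrefl by (intro psubset_card_mono) auto
    then show "\<pi> i \<in> {1..n}" unfolding \<pi>_def by simp
  qed
  ultimately have "bij_betw \<pi> {..<n} {1..n}"
    by (simp add: bij_betw_def card_image card_subset_eq)
  moreover have "\<pi> (i + n) = \<pi> i" for i using mod[of "i + n"] mod[of i] by simp
  ultimately have "ranking n \<pi>" by (simp add: ranking_def)
  then show ?thesis using iff by blast
qed

lemma compatible_Suc:
  "compatible \<pi> s \<Longrightarrow> \<pi> i < \<pi> j \<Longrightarrow> s !! i = s !! j \<Longrightarrow> \<pi> (Suc j) < \<pi> (Suc i)"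
  unfolding compatible_def by (metis less_irrefl)

text \<open>Each common letter reverses the comparison once.\<close>

lemma compatible_add:
  assumes "compatible \<pi> s" "\<pi> i < \<pi> j" "\<And>e. e < d \<Longrightarrow> s !! (i + e) = s !! (j + e)"
  shows "if even d then \<pi> (i + d) < \<pi> (j + d) else \<pi> (j + d) < \<pi> (i + d)"
  using assms(3)
proof (induction d)
  case 0
  show ?case using assms(2) by simp
next
  case (Suc d)
  then have "if even d then \<pi> (i + d) < \<pi> (j + d) else \<pi> (j + d) < \<pi> (i + d)" by simp
  moreover have "s !! (i + d) = s !! (j + d)" using Suc.prems by simp
  ultimately show ?case using compatible_Suc[OF assms(1)] by (auto split: if_splits)
qed

text \<open>The comparison is carried to the first disagreement \<open>d\<close>, being reversed
  \<open>d\<close> times. There compatibility forces the letters to be ordered like the ranks. Hence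
  a compatible ranking is free only on ties.\<close>

lemma compatible_imp_alt_less:
  assumes "compatible \<pi> s" "\<pi> i < \<pi> j" "sdrop i s \<noteq> sdrop j s"
  shows "alt_less (sdrop i s) (sdrop j s)"
proof -
  have ex: "\<exists>d. s !! (i + d) \<noteq> s !! (j + d)"
    using assms(3) stream_eq_snthI[of "sdrop i s" "sdrop j s"] by (auto simp: sdrop_snth)
  define d where "d = (LEAST d. s !! (i + d) \<noteq> s !! (j + d))"
  have d: "s !! (i + d) \<noteq> s !! (j + d)" unfolding d_def using ex by (rule LeastI_ex)
  have eq: "s !! (i + e) = s !! (j + e)" if "e < d" for e
    using that unfolding d_def using not_less_Least by blast
  from compatible_add[OF assms(1,2) eq]
  have "if even d then \<pi> (i + d) < \<pi> (j + d) else \<pi> (j + d) < \<pi> (i + d)" by simp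
  with d assms(1) have "if even d then s !! (i + d) < s !! (j + d) else s !! (j + d) < s !! (i + d)"
    unfolding compatible_def by (metis (full_types))
  with eq show ?thesis unfolding alt_less_def sdrop_snth by blast
qed

lemma compatible_less_iff:
  assumes "ranking n \<pi>" "n > 0" "compatible \<pi> s" "sdrop n s = s" "sdrop i s \<noteq> sdrop j s"
  shows "\<pi> i < \<pi> j \<longleftrightarrow> alt_less (sdrop i s) (sdrop j s)"
proof
  show "alt_less (sdrop i s) (sdrop j s)" if "\<pi> i < \<pi> j"
    using that assms(3,5) by (blast intro: compatible_imp_alt_less)
  assume less: "alt_less (sdrop i s) (sdrop j s)"
  show "\<pi> i < \<pi> j"
  proof (rule ccontr)
    assume nless: "\<not> \<pi> i < \<pi> j"
    have "i mod n \<noteq> j mod n"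
      using assms(5) sdrop_mod_period[OF assms(4)] by metis
    then have "\<pi> j < \<pi> i" using ranking_eq_iff[OF assms(1,2)] nless by (metis linorder_neqE_nat)
    then have "alt_less (sdrop j s) (sdrop i s)"
      using compatible_imp_alt_less[OF assms(3)] assms(5) by metis
    with less show False using alt_less_trans not_alt_less_refl by blast
  qed
qed

text \<open>
  The shift by an even period preserves the order of the ranks, so the ranks along its orbits are
  monotone; being periodic, they are constant.
\<close>

lemma compatible_even_period:
  assumes "ranking n \<pi>" "n > 0" "compatible \<pi> s" "sdrop m s = s" "even m"
  shows "n dvd m"
proof -
  have shift: "\<pi> (i + m) < \<pi> (j + m)" if "\<pi> i < \<pi> j" "sdrop i s = sdrop j s" for i j
  proof -
    have "s !! (i + e) = s !! (j + e)" for e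
      using that(2) by (metis sdrop_snth)
    then show ?thesis using compatible_add[OF assms(3) that(1), of m] assms(5) by simp
  qed
  have eq: "sdrop (l * m) s = s" for l using sdrop_mult_period[OF assms(4)] .
  have per: "\<pi> (n * m) = \<pi> 0"
    using ranking_eq_iff[OF assms(1,2)] by simp
  have "\<pi> 0 = \<pi> m"
  proof (cases "\<pi> 0" "\<pi> m" rule: linorder_cases)
    case less
    have "\<pi> (l * m) < \<pi> (Suc l * m)" for l
    proof (induction l)
      case (Suc l)
      then show ?case using shift[of "l * m" "Suc l * m"] eq[of l] eq[of "Suc l"]
        by (simp add: add.commute)
    qed (use less in simp)
    then have "\<pi> (0 * m) < \<pi> (n * m)" by (rule lift_Suc_mono_less[where f = "\<lambda>l. \<pi> (l * m)"]) (fact assms(2))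
    then show ?thesis using per by simp
  next
    case greater
    have dec: "\<pi> (Suc l * m) < \<pi> (l * m)" for l
    proof (induction l)
      case (Suc l)
      then show ?case using shift[of "Suc l * m" "l * m"] eq[of l] eq[of "Suc l"]
        by (simp add: add.commute)
    qed (use greater in simp)
    have "\<pi> (Suc l * m) < \<pi> 0" for l
    proof (induction l)
      case (Suc l)
      then show ?case using dec[of "Suc l"] by linarith
    qed (use greater in simp)
    from this[of "n - 1"] show ?thesis using per assms(2) by simp
  qed
  then show ?thesis using ranking_eq_iff[OF assms(1,2), of 0 m] by (simp add: dvd_eq_mod_eq_0)
qed

text \<open>An even minimal period is a multiple of \<open>n\<close> by
  \<open>compatible_even_period\<close>. For odd \<open>p\<close> the same applies to the period
  \<open>2 * p\<close>, which leaves a quotient of 1 or 2.\<close>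

lemma compatible_period_cases:
  assumes "ranking n \<pi>" "n > 0" "compatible \<pi> s" "s \<in> primitive_streams k p" "p dvd n"
  shows "n = p \<or> n = 2 * p \<and> odd p"
proof -
  have p: "sdrop p s = s" "p > 0"
    using assms(4) by (simp_all add: primitive_streams_def periodic_streams_def)
  show ?thesis
  proof (cases "even p")
    case True
    then have "n dvd p" by (rule compatible_even_period[OF assms(1-3) p(1)])
    with assms(5) show ?thesis by (blast dest: dvd_antisym)
  next
    case False
    have "n dvd 2 * p"
      using compatible_even_period[OF assms(1-3) sdrop_mult_period[OF p(1), of 2]] by simp
    moreover obtain q where q: "n = p * q" using assms(5) by blast
    ultimately have "q dvd 2" using p(2) by (simp add: mult.commute)
    then have "q \<le> 2" by (rule dvd_imp_le) simp
    moreover have "q \<noteq> 0" using q assms(2) by (cases q) auto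
    ultimately have "q = 1 \<or> q = 2" by linarith
    with q False show ?thesis by auto
  qed
qed

text \<open>
  If \<open>n = 2 * p\<close> with \<open>p\<close> odd, the positions \<open>i\<close> and \<open>i + p\<close> carry the same word but have
  opposite parity. Parity alternates along the shift, so it breaks all ties consistently; the
  parameter \<open>b\<close> selects one of the two ways.
\<close>

lemma compatible_exists:
  assumes s: "s \<in> primitive_streams k p" and n: "n = p \<or> n = 2 * p \<and> odd p"
  obtains \<pi> where "ranking n \<pi>" "compatible \<pi> s"
    "\<And>i j. n = 2 * p \<Longrightarrow> sdrop i s = sdrop j s \<Longrightarrow> \<pi> i < \<pi> j \<longleftrightarrow> (i + b) mod 2 < (j + b) mod 2"
proof -
  \<comment> \<open>Since \<open>p > 0\<close>, the tie-break is inactive for \<open>n = p\<close>,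
    where distinct residues carry distinct words.\<close>
  define R where "R i j \<longleftrightarrow> alt_less (sdrop i s) (sdrop j s) \<or>
    sdrop i s = sdrop j s \<and> n = 2 * p \<and> (i + b) mod 2 < (j + b) mod 2" for i j
  have p: "sdrop p s = s" "p > 0"
    using s by (simp_all add: primitive_streams_def periodic_streams_def)
  have sn: "sdrop n s = s" using n p(1) sdrop_mult_period[OF p(1), of 2] by (elim disjE conjE) simp_all
  have "n > 0" using n p(2) by auto
  moreover have "\<not> R i i" for i by (simp add: R_def not_alt_less_refl)
  moreover have "R i l" if "R i j" "R j l" for i j l
    using that unfolding R_def by (elim disjE conjE) (auto intro: alt_less_trans)
  moreover have "R i j \<or> R j i" if "i mod n \<noteq> j mod n" for i j
  proof (cases "sdrop i s = sdrop j s")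
    case True
    then have ij: "i mod p = j mod p" using primitive_streams_sdrop_eq_iff[OF s] by simp
    with that n have n2: "n = 2 * p" "odd p" by auto
    \<comment> \<open>Positions that agree modulo \<open>p\<close> but not modulo \<open>n\<close>
      differ in the parity of the quotient by \<open>p\<close>. As \<open>p\<close> is odd, this
      becomes a difference in the parity of the positions themselves.\<close>
    have "i mod n = p * (i div p mod 2) + i mod p" "j mod n = p * (j div p mod 2) + j mod p"
      using mod_mult2_eq[of _ p 2] n2 by (simp_all add: mult.commute)
    with that ij have "i div p mod 2 \<noteq> j div p mod 2" by metis
    moreover have "even a \<noteq> even c" if "a mod 2 \<noteq> c mod 2" for a c :: nat
      using that by presburger
    ultimately have "even (i div p) \<noteq> even (j div p)" by blast
    moreover have parity: "odd i \<longleftrightarrow> (odd (i div p) \<noteq> odd (i mod p))" for i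
    proof -
      have "odd i \<longleftrightarrow> odd (p * (i div p) + i mod p)" by simp
      then show ?thesis using n2(2) by (simp only: even_add even_mult_iff) blast
    qed
    ultimately have "even i \<noteq> even j" using parity[of i, unfolded ij] parity[of j] by blast
    then have "(i + b) mod 2 \<noteq> (j + b) mod 2" by presburger
    then have "(i + b) mod 2 < (j + b) mod 2 \<or> (j + b) mod 2 < (i + b) mod 2" by linarith
    with True n2(1) show ?thesis unfolding R_def by auto
  qed (auto simp: R_def dest: alt_less_linear)
  moreover have "R (i mod n) (j mod n) \<longleftrightarrow> R i j" for i j
  proof -
    have "(i mod n + b) mod 2 = (i + b) mod 2" if "n = 2 * p" for i
    proof -
      have "i mod n mod 2 = i mod 2" using that by (simp add: mod_mod_cancel)
      then show ?thesis by (rule mod_add_cong) (rule refl)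
    qed
    then show ?thesis unfolding R_def using sdrop_mod_period[OF sn] by auto
  qed
  ultimately have "\<exists>\<pi>. ranking n \<pi> \<and> (\<forall>i j. \<pi> i < \<pi> j \<longleftrightarrow> R i j)"
    by (rule ranking_exists[of n R])
  then obtain \<pi> where \<pi>: "ranking n \<pi>" "\<And>i j. \<pi> i < \<pi> j \<longleftrightarrow> R i j" by blast
  have "compatible \<pi> s"
    unfolding compatible_def \<pi>(2)
  proof (intro allI impI)
    fix i j assume "R i j"
    then consider "alt_less (sdrop i s) (sdrop j s)"
      | "sdrop i s = sdrop j s" "n = 2 * p" "(i + b) mod 2 < (j + b) mod 2"
      unfolding R_def by blast
    then show "s !! i < s !! j \<or> s !! i = s !! j \<and> R (Suc j) (Suc i)"
    proof cases
      case 1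
      then show ?thesis using alt_less_stl[OF 1] by (auto simp: R_def)
    next
      case 2
      then have "s !! i = s !! j" "sdrop (Suc i) s = sdrop (Suc j) s"
        by (simp_all only: sdrop_simps[symmetric])
      \<comment> \<open>Passing to the successors flips both parities, so the tie-break reverses as
        compatibility demands.\<close>
      moreover have "(Suc j + b) mod 2 < (Suc i + b) mod 2" using 2(3) by presburger
      ultimately show ?thesis using 2(2) by (simp add: R_def)
    qed
  qed
  moreover have "\<pi> i < \<pi> j \<longleftrightarrow> (i + b) mod 2 < (j + b) mod 2"
    if "n = 2 * p" "sdrop i s = sdrop j s" for i j
    using that by (simp add: \<pi>(2) R_def not_alt_less_refl)
  ultimately show ?thesis by (rule that[OF \<pi>(1)])
qed

section \<open>Counting the rankings compatible with a given stream\<close>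

lemma compatible_unique:
  assumes "ranking n \<pi>" "ranking n \<rho>" "compatible \<pi> s" "compatible \<rho> s"
    and "n > 0" "sdrop n s = s"
    and "\<And>i j. sdrop i s = sdrop j s \<Longrightarrow> \<pi> i < \<pi> j \<longleftrightarrow> \<rho> i < \<rho> j"
  shows "\<pi> = \<rho>"
proof (rule ranking_unique[OF assms(1,2,5)])
  fix i j show "\<pi> i < \<pi> j \<longleftrightarrow> \<rho> i < \<rho> j"
    using assms(7)[of i j] compatible_less_iff[OF assms(1,5,3,6), of i j]
      compatible_less_iff[OF assms(2,5,4,6), of i j] by argo
qed

text \<open>Equal words occur only at positions congruent modulo \<open>n\<close>, where the ranks
  coincide anyway, so there is no tie to break.\<close>

lemma card_compatible_primitive:
  assumes s: "s \<in> primitive_streams k n"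
  shows "card {\<pi>. ranking n \<pi> \<and> compatible \<pi> s} = 1"
proof -
  have n: "n > 0" "sdrop n s = s"
    using s by (simp_all add: primitive_streams_def periodic_streams_def)
  obtain \<pi> where \<pi>: "ranking n \<pi>" "compatible \<pi> s"
    by (rule compatible_exists[OF s, of n]) auto
  have "\<rho> = \<pi>" if \<rho>: "ranking n \<rho>" "compatible \<rho> s" for \<rho>
  proof (rule compatible_unique[OF \<rho>(1) \<pi>(1) \<rho>(2) \<pi>(2) n])
    fix i j assume "sdrop i s = sdrop j s"
    then show "\<rho> i < \<rho> j \<longleftrightarrow> \<pi> i < \<pi> j"
      using primitive_streams_sdrop_eq_iff[OF s] ranking_eq_iff[OF _ n(1)] \<rho>(1) \<pi>(1)
      by (metis less_irrefl)
  qed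
  with \<pi> have "{\<pi>. ranking n \<pi> \<and> compatible \<pi> s} = {\<pi>}" by blast
  then show ?thesis by simp
qed

text \<open>All ties are between \<open>i\<close> and \<open>i + p\<close>, and the comparison at
  \<open>i = 0\<close> determines the others.\<close>

lemma card_compatible_double:
  assumes s: "s \<in> primitive_streams k p" and "odd p"
  shows "card {\<pi>. ranking (2 * p) \<pi> \<and> compatible \<pi> s} = 2"
proof -
  define n where "n = 2 * p"
  have p: "p > 0" "sdrop p s = s"
    using s by (simp_all add: primitive_streams_def periodic_streams_def)
  have n: "n > 0" "sdrop n s = s"
    using p sdrop_mult_period[OF p(2), of 2] by (simp_all add: n_def)
  have ex: "\<exists>\<pi>. ranking n \<pi> \<and> compatible \<pi> s \<and>
    (\<forall>i j. sdrop i s = sdrop j s \<longrightarrow> (\<pi> i < \<pi> j \<longleftrightarrow> (i + b) mod 2 < (j + b) mod 2))" for b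
    by (rule compatible_exists[OF s, of n b]) (use assms(2) in \<open>auto simp: n_def\<close>)
  obtain f where f: "\<And>b. ranking n (f b)" "\<And>b. compatible (f b) s"
    "\<And>b i j. sdrop i s = sdrop j s \<Longrightarrow> f b i < f b j \<longleftrightarrow> (i + b) mod 2 < (j + b) mod 2"
    using ex by metis
  \<comment> \<open>For odd \<open>p\<close> the ranking \<open>f b\<close> places position 0 below
    position \<open>p\<close> exactly when \<open>b\<close> is even, so \<open>b\<close> is read off
    from that comparison.\<close>
  have "\<rho> = f (if \<rho> 0 < \<rho> p then 0 else 1)" if \<rho>: "ranking n \<rho>" "compatible \<rho> s" for \<rho>
  proof (rule compatible_unique[OF \<rho>(1) f(1) \<rho>(2) f(2) n])
    define b :: nat where "b = (if \<rho> 0 < \<rho> p then 0 else 1)"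
    fix i j assume ij: "sdrop i s = sdrop j s"
    have neq: "\<rho> i \<noteq> \<rho> (i + p)" for i
    proof
      assume "\<rho> i = \<rho> (i + p)"
      then have "i mod n = (i + p) mod n" using ranking_eq_iff[OF \<rho>(1) n(1)] by simp
      then have "n dvd p" by (metis add_diff_cancel_left' le_add1 mod_eq_dvd_iff_nat)
      then show False using p(1) by (auto simp: n_def dest: dvd_imp_le)
    qed
    \<comment> \<open>The positions \<open>i\<close> and \<open>i + p\<close> carry the same letter,
      so each step reverses their comparison.\<close>
    have flip: "\<rho> i < \<rho> (i + p) \<longleftrightarrow> even (i + b)" for i
    proof (induction i)
      case 0
      then show ?case by (simp add: b_def)
    next
      case (Suc i)
      have "s !! i = s !! (i + p)" using p(2) by (metis add.commute sdrop_snth)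
      then have "\<rho> (Suc i) < \<rho> (Suc i + p) \<longleftrightarrow> \<not> \<rho> i < \<rho> (i + p)"
        using compatible_Suc[OF \<rho>(2), of i "i + p"] compatible_Suc[OF \<rho>(2), of "i + p" i] neq[of i]
        by (metis add_Suc less_asym linorder_neqE_nat)
      then show ?case using Suc by simp
    qed
    have ijp: "i mod p = j mod p" using ij primitive_streams_sdrop_eq_iff[OF s] by simp
    show "\<rho> i < \<rho> j \<longleftrightarrow> f b i < f b j"
    proof (cases "i mod n = j mod n")
      case True
      then show ?thesis
        using ranking_eq_iff[OF \<rho>(1) n(1), of i j] ranking_eq_iff[OF f(1) n(1), of b i j] by simp
    next
      case False
      \<comment> \<open>A residue modulo \<open>p\<close> has just two lifts modulo
        \<open>2 * p\<close>, and \<open>j\<close> is not the one given by \<open>i\<close>.\<close>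
      have "j mod n = (i + p) mod n"
      proof -
        have "i mod n = p * (i div p mod 2) + i mod p" "j mod n = p * (j div p mod 2) + j mod p"
          "(i + p) mod n = p * ((i + p) div p mod 2) + (i + p) mod p"
          using mod_mult2_eq[of _ p 2] by (simp_all add: n_def mult.commute)
        moreover from this have "i div p mod 2 \<noteq> j div p mod 2" using False ijp by auto
        then have "(i + p) div p mod 2 = j div p mod 2" using p(1) by (auto simp: mod2_eq_if split: if_splits)
        ultimately show ?thesis using ijp by simp
      qed
      then have eq: "\<rho> j = \<rho> (i + p)" "f b j = f b (i + p)"
        using ranking_eq_iff[OF \<rho>(1) n(1)] ranking_eq_iff[OF f(1) n(1)] by auto
      have "sdrop i s = sdrop (i + p) s"
        using primitive_streams_sdrop_eq_iff[OF s] by simp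
      then have "f b i < f b (i + p) \<longleftrightarrow> (i + b) mod 2 < (i + p + b) mod 2" by (rule f(3))
      also have "\<dots> \<longleftrightarrow> even (i + b)" using assms(2) by presburger
      finally show ?thesis using flip[of i] eq by simp
    qed
  qed
  then have "\<rho> \<in> {f 0, f 1}" if "ranking n \<rho>" "compatible \<rho> s" for \<rho>
    using that by (metis insertCI)
  then have "{\<pi>. ranking n \<pi> \<and> compatible \<pi> s} = {f 0, f 1}" using f(1,2) by blast
  moreover have "f 0 \<noteq> f 1"
  proof -
    have "f 0 0 < f 0 p" "\<not> f 1 0 < f 1 p"
      using f(3)[of 0 p 0] f(3)[of 0 p 1] p(2) assms(2) by (auto simp: mod2_eq_if)
    then show ?thesis by metis
  qed
  ultimately show ?thesis by (simp add: n_def)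
qed

text \<open>The pairs are counted stream by stream: the fibre has one element for minimal period
  \<open>n\<close>, two if the minimal period is \<open>n div 2\<close> and odd, and none
  otherwise.\<close>

lemma card_compatible_pairs:
  assumes "n > 0"
  shows "card {(\<pi>, s). s \<in> periodic_streams k n \<and> ranking n \<pi> \<and> compatible \<pi> s}
    = card (primitive_streams k n)
      + (if n mod 4 = 2 then 2 * card (primitive_streams k (n div 2)) else 0)"
proof -
  define F where "F s = {\<pi>. ranking n \<pi> \<and> compatible \<pi> s}" for s :: "nat stream"
  \<comment> \<open>The condition \<open>n mod 4 = 2\<close> says that \<open>n\<close> is twice an
    odd number.\<close>
  define D where "D = (if n mod 4 = 2 then primitive_streams k (n div 2) else {})"
  have half: "n = 2 * (n div 2)" "odd (n div 2)" if "n mod 4 = 2" using that by presburger+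
  have cardF1: "card (F s) = 1" if "s \<in> primitive_streams k n" for s
    using card_compatible_primitive[OF that] by (simp add: F_def)
  have cardF2: "card (F s) = 2" if "s \<in> D" for s
  proof -
    have "n mod 4 = 2" "s \<in> primitive_streams k (n div 2)" using that by (auto simp: D_def split: if_splits)
    then show ?thesis using card_compatible_double[of s k "n div 2"] half by (simp add: F_def)
  qed
  have empty: "F s = {}" if "s \<in> periodic_streams k n" "s \<notin> primitive_streams k n \<union> D" for s
  proof (rule ccontr)
    assume "F s \<noteq> {}"
    then obtain \<pi> where \<pi>: "ranking n \<pi>" "compatible \<pi> s" by (auto simp: F_def)
    from that(1) have "s \<in> (\<Union>d\<in>{d. d dvd n}. primitive_streams k d)"
      by (simp only: periodic_streams_eq_Union[OF assms])
    then obtain p where p: "p dvd n" "s \<in> primitive_streams k p" by blast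
    from compatible_period_cases[OF \<pi>(1) assms \<pi>(2) p(2,1)] show False
    proof (elim disjE conjE)
      assume "n = 2 * p" "odd p"
      then have "n mod 4 = 2" "n div 2 = p" by (presburger, simp)
      with that(2) p(2) show False by (simp add: D_def)
    qed (use that(2) p(2) in simp)
  qed
  have sub: "primitive_streams k n \<union> D \<subseteq> periodic_streams k n"
  proof (rule Un_least)
    show "primitive_streams k n \<subseteq> periodic_streams k n"
      by (auto simp: primitive_streams_def)
    have "n div 2 dvd n" if "n mod 4 = 2" using half(1)[OF that] by (metis dvd_triv_right)
    then show "D \<subseteq> periodic_streams k n"
      unfolding periodic_streams_eq_Union[OF assms] D_def by auto
  qed
  have disj: "primitive_streams k n \<inter> D = {}"
    using assms disjoint_primitive_streams[of n "n div 2" k] by (simp add: D_def)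
  have fin: "finite (F s)" if "s \<in> periodic_streams k n" for s
  proof (cases "s \<in> primitive_streams k n \<union> D")
    case True
    \<comment> \<open>An infinite set has \<open>card\<close> 0, so a positive value yields
      finiteness.\<close>
    then have "card (F s) > 0" using cardF1 cardF2 by auto
    then show ?thesis by (simp add: card_gt_0_iff)
  qed (use empty[OF that] in simp)
  have "{(\<pi>, s). s \<in> periodic_streams k n \<and> ranking n \<pi> \<and> compatible \<pi> s}
      = prod.swap ` (SIGMA s:periodic_streams k n. F s)"
    by (auto simp: F_def image_iff)
  then have "card {(\<pi>, s). s \<in> periodic_streams k n \<and> ranking n \<pi> \<and> compatible \<pi> s}
      = card (SIGMA s:periodic_streams k n. F s)"
    by (simp add: card_image)
  also have "\<dots> = (\<Sum>s\<in>periodic_streams k n. card (F s))"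
    using fin by (intro card_SigmaI) (auto simp: finite_periodic_streams assms)
  also have "\<dots> = (\<Sum>s\<in>primitive_streams k n \<union> D. card (F s))"
    using sub empty by (intro sum.mono_neutral_right) (auto simp: finite_periodic_streams assms)
  also have "\<dots> = (\<Sum>s\<in>primitive_streams k n. card (F s)) + (\<Sum>s\<in>D. card (F s))"
    using disj by (intro sum.union_disjoint) (auto simp: finite_primitive_streams D_def)
  also have "\<dots> = card (primitive_streams k n) + 2 * card D"
    using cardF1 cardF2 by simp
  finally show ?thesis by (simp add: D_def)
qed

section \<open>Cycles with one ascent\<close>

text \<open>The equation \<open>card (ascents n \<tau>) + 1 = 2\<close> keeps the shape of
  \<open>num_cyclic_ascents n 2\<close>.\<close>

definition one_ascent_cycles :: "nat \<Rightarrow> (nat \<Rightarrow> nat) set" where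
  "one_ascent_cycles n =
     {\<tau>. \<tau> permutes {1..n} \<and> cyclic_on \<tau> {1..n} \<and> card (ascents n \<tau>) + 1 = 2}"

text \<open>Symbolic coding of the trajectory of \<open>x\<close>: letter 0 up to the ascent, letter
  1 above it. \<open>siterate\<close> begins with \<open>x\<close> itself, so entry \<open>i\<close>
  codes \<open>(\<tau> ^^ i) x\<close>.\<close>

definition itinerary :: "nat \<Rightarrow> (nat \<Rightarrow> nat) \<Rightarrow> nat \<Rightarrow> nat stream" where
  "itinerary n \<tau> x =
     smap (\<lambda>y. if y \<le> the_elem (ascents n \<tau>) then 0 else 1) (siterate \<tau> x)"

text \<open>The orbit of \<open>x\<close> is the whole set \<open>{1..n}\<close>, so the first
  return to \<open>x\<close> takes exactly \<open>n\<close> steps.\<close>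

lemma ranking_funpow:
  assumes "cyclic_on \<tau> {1..n}" "x \<in> {1..n}"
  shows "ranking n (\<lambda>i. (\<tau> ^^ i) x)"
proof -
  have orb: "orbit \<tau> x = {1..n}" using orbit_cyclic_eq3[OF assms] .
  then have x: "x \<in> orbit \<tau> x" using assms(2) by simp
  define m where "m = funpow_dist1 \<tau> x x"
  have inj: "inj_on (\<lambda>i. (\<tau> ^^ i) x) {..<m}" and img: "(\<lambda>i. (\<tau> ^^ i) x) ` {..<m} = {1..n}"
    using inj_on_funpow_dist1[OF x] orbit_conv_funpow_dist1[OF x] orb
    by (auto simp: m_def atLeast0LessThan)
  have "m = n" using card_image[OF inj] img by simp
  moreover have "(\<tau> ^^ m) x = x" unfolding m_def by (rule funpow_dist1_prop[OF x])
  ultimately show ?thesis using inj img by (simp add: ranking_def bij_betw_def funpow_add)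
qed

lemma decreasing_on_interval:
  fixes f :: "nat \<Rightarrow> nat"
  assumes "\<And>y. a \<le> y \<Longrightarrow> y < b \<Longrightarrow> f (Suc y) < f y" "a \<le> y" "y < z" "z \<le> b"
  shows "f z < f y"
  using assms(3,4)
proof (induction z)
  case (Suc z)
  then have "f (Suc z) < f z" using assms(1,2) by simp
  then show ?case using Suc by (cases "y = z") auto
qed simp

lemma not_ascent:
  assumes "\<tau> permutes {1..n}" "1 \<le> y" "y < n" "y \<notin> ascents n \<tau>"
  shows "\<tau> (Suc y) < \<tau> y"
proof -
  have "\<tau> (Suc y) \<noteq> \<tau> y" using permutes_inj[OF assms(1)] by (auto simp: inj_eq)
  then show ?thesis using assms(2-4) by (auto simp: ascents_def)
qed

lemma itinerary_compatible:
  assumes "\<tau> \<in> one_ascent_cycles n" "x \<in> {1..n}"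
  shows "itinerary n \<tau> x \<in> periodic_streams 2 n" "ranking n (\<lambda>i. (\<tau> ^^ i) x)"
    "compatible (\<lambda>i. (\<tau> ^^ i) x) (itinerary n \<tau> x)"
proof -
  have \<tau>: "\<tau> permutes {1..n}" "cyclic_on \<tau> {1..n}" "card (ascents n \<tau>) = 1"
    using assms(1) by (auto simp: one_ascent_cycles_def)
  from \<tau>(3) obtain z where z: "ascents n \<tau> = {z}" by (auto simp: card_1_singleton_iff)
  show rank: "ranking n (\<lambda>i. (\<tau> ^^ i) x)" using \<tau>(2) assms(2) by (rule ranking_funpow)
  have range: "(\<tau> ^^ i) x \<in> {1..n}" for i using cyclic_on_funpow_in[OF \<tau>(2) assms(2)] .
  have "sdrop n (itinerary n \<tau> x) = itinerary n \<tau> x"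
  proof (rule stream_eq_snthI)
    fix i
    have "(\<tau> ^^ (i + n)) x = (\<tau> ^^ i) x" using rank by (simp add: ranking_def)
    then show "sdrop n (itinerary n \<tau> x) !! i = itinerary n \<tau> x !! i"
      by (simp only: itinerary_def sdrop_snth snth_smap snth_siterate add.commute[of n])
  qed
  then show "itinerary n \<tau> x \<in> periodic_streams 2 n"
    by (auto simp: periodic_streams_def itinerary_def sset_range)
  \<comment> \<open>The ascent at \<open>z\<close> compares \<open>z\<close> with
    \<open>z + 1\<close>, so \<open>z\<close> belongs to the lower block; no ascent separates two
    points of the same block.\<close>
  have dec: "\<tau> w < \<tau> y" if "1 \<le> y" "y < w" "w \<le> n" "w \<le> z \<or> z < y" for y w
  proof (rule decreasing_on_interval[of y w \<tau> y w])
    fix v assume "y \<le> v" "v < w"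
    then show "\<tau> (Suc v) < \<tau> v" using that z by (intro not_ascent[OF \<tau>(1)]) auto
  qed (use that in auto)
  show "compatible (\<lambda>i. (\<tau> ^^ i) x) (itinerary n \<tau> x)"
    unfolding compatible_def
  proof (intro allI impI)
    fix i j assume less: "(\<tau> ^^ i) x < (\<tau> ^^ j) x"
    then show "itinerary n \<tau> x !! i < itinerary n \<tau> x !! j \<or>
      itinerary n \<tau> x !! i = itinerary n \<tau> x !! j \<and> (\<tau> ^^ Suc j) x < (\<tau> ^^ Suc i) x"
      using dec[of "(\<tau> ^^ i) x" "(\<tau> ^^ j) x"] range[of i] range[of j] z
      by (auto simp: itinerary_def)
  qed
qed

text \<open>The inverse of coding: the cycle is recovered from the ranking as the map sending the
  rank of each position to the rank of the next one.\<close>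

lemma compatible_imp_itinerary:
  assumes "n \<ge> 3" "s \<in> periodic_streams 2 n" "ranking n \<pi>" "compatible \<pi> s"
  obtains \<tau> where "\<tau> \<in> one_ascent_cycles n" "\<pi> = (\<lambda>i. (\<tau> ^^ i) (\<pi> 0))"
    "s = itinerary n \<tau> (\<pi> 0)"
proof -
  have n: "n > 0" using assms(1) by simp
  have sn: "sdrop n s = s" and bin: "s !! i < 2" for i
    using assms(2) by (auto simp: periodic_streams_def sset_range)
  \<comment> \<open>Outside \<open>{1..n}\<close> the map is the identity, as
    \<open>permutes\<close> requires.\<close>
  define \<tau> where "\<tau> y = (if y \<in> {1..n} then \<pi> (Suc (inv_into {..<n} \<pi> y)) else y)" for y
  have range: "\<pi> i \<in> {1..n}" for i by (rule ranking_in_range[OF assms(3) n])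
  have step: "\<tau> (\<pi> i) = \<pi> (Suc i)" for i
  proof -
    have "inv_into {..<n} \<pi> (\<pi> (i mod n)) = i mod n"
      using assms(3) n by (intro inv_into_f_f) (auto simp: ranking_def bij_betw_def)
    then have "\<tau> (\<pi> i) = \<pi> (Suc (i mod n))"
      using range by (simp only: \<tau>_def ranking_mod[OF assms(3)] if_True)
    also have "\<dots> = \<pi> (Suc i)"
      using ranking_eq_iff[OF assms(3) n] by (simp add: mod_Suc_eq)
    finally show ?thesis .
  qed
  have iter: "(\<tau> ^^ i) (\<pi> 0) = \<pi> i" for i by (induction i) (simp_all add: step)
  have img: "\<tau> ` {1..n} = {1..n}"
  proof (intro equalityI subsetI)
    fix y assume "y \<in> {1..n}"
    then obtain i where i: "i < n" "\<pi> i = y" by (rule ranking_surj[OF assms(3)])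
    have "\<tau> (\<pi> (i + (n - 1))) = \<pi> (i + n)" using step[of "i + (n - 1)"] n by simp
    also have "\<dots> = y" using i assms(3) by (simp add: ranking_def)
    finally show "y \<in> \<tau> ` {1..n}" using range by blast
  qed (use range in \<open>auto simp: \<tau>_def simp del: One_nat_def\<close>)
  have perm: "\<tau> permutes {1..n}"
  proof (rule bij_imp_permutes)
    show "bij_betw \<tau> {1..n} {1..n}"
      using img by (simp add: bij_betw_def eq_card_imp_inj_on)
  qed (auto simp: \<tau>_def)
  have "orbit \<tau> (\<pi> 0) = {1..n}"
  proof (intro equalityI subsetI)
    fix y assume "y \<in> {1..n}"
    then obtain i where i: "i < n" "\<pi> i = y" by (rule ranking_surj[OF assms(3)])
    \<comment> \<open>\<open>orbit\<close> collects positive iterates only, so a full period is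
      added to cover \<open>i = 0\<close>.\<close>
    then have "(\<tau> ^^ (i + n)) (\<pi> 0) = y" using assms(3) unfolding iter by (simp add: ranking_def)
    then show "y \<in> orbit \<tau> (\<pi> 0)" unfolding orbit_altdef using n by blast
  qed (use range in \<open>auto simp: orbit_altdef iter simp del: One_nat_def\<close>)
  then have cyc: "cyclic_on \<tau> {1..n}" using range[of 0] unfolding cyclic_on_def by blast
  \<comment> \<open>The maximum will be the largest rank with letter 0. Inserting 0 keeps the set
    nonempty even before that letter is known to occur.\<close>
  define Z where "Z = insert 0 {\<pi> i | i. s !! i = 0}"
  have "Z \<subseteq> {..n}" using range by (auto simp: Z_def)
  then have finZ: "finite Z" by (rule finite_subset) simp
  define z where "z = Max Z"
  have zero_iff: "s !! i = 0 \<longleftrightarrow> \<pi> i \<le> z" for i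
  proof
    assume "s !! i = 0"
    then show "\<pi> i \<le> z" unfolding z_def using finZ by (intro Max_ge) (auto simp: Z_def)
  next
    assume le: "\<pi> i \<le> z"
    have "z \<in> Z" unfolding z_def using finZ by (intro Max_in) (auto simp: Z_def)
    moreover have "z \<noteq> 0" using le range[of i] by auto
    ultimately obtain j where j: "z = \<pi> j" "s !! j = 0" by (auto simp: Z_def)
    show "s !! i = 0"
    proof (cases "\<pi> i = \<pi> j")
      case True
      then have "i mod n = j mod n" using ranking_eq_iff[OF assms(3) n] by simp
      then have "sdrop i s = sdrop j s" using sdrop_mod_period[OF sn] by metis
      then show ?thesis using j(2) by (metis sdrop_simps(1))
    next
      case False
      then have "\<pi> i < \<pi> j" using le j by simp
      then show ?thesis using assms(4) j(2) unfolding compatible_def by fastforce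
    qed
  qed
  \<comment> \<open>At an ascent the order of neighbouring ranks is not reversed, so their letters
    differ and must be 0 and 1. The lower rank is thus the last one with letter 0.\<close>
  have "ascents n \<tau> \<subseteq> {z}"
  proof
    fix y assume y: "y \<in> ascents n \<tau>"
    then have "y \<in> {1..n}" "Suc y \<in> {1..n}" and asc: "\<tau> y < \<tau> (Suc y)" by (auto simp: ascents_def)
    then obtain i j where ij: "\<pi> i = y" "\<pi> j = Suc y" using ranking_surj[OF assms(3)] by metis
    then have "\<pi> (Suc i) < \<pi> (Suc j)" using asc step by metis
    then have "s !! i < s !! j" using assms(4) ij unfolding compatible_def by (metis lessI less_asym)
    then have "s !! i = 0" "s !! j \<noteq> 0" using bin[of j] by auto
    then show "y \<in> {z}" using zero_iff ij by auto
  qed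
  moreover have "ascents n \<tau> \<noteq> {}"
  proof
    assume "ascents n \<tau> = {}"
    then have dec: "\<tau> w < \<tau> y" if "1 \<le> y" "y < w" "w \<le> n" for y w
      using that by (intro decreasing_on_interval[of 1 n \<tau> y w] not_ascent[OF perm]) auto
    \<comment> \<open>A decreasing \<open>\<tau>\<close> would make the constant stream compatible.
      Its even period 2 would then be a multiple of \<open>n\<close>, contradicting
      \<open>n \<ge> 3\<close>.\<close>
    have "compatible \<pi> (sconst (0::nat))"
      unfolding compatible_def
    proof (intro allI impI)
      fix i j assume "\<pi> i < \<pi> j"
      then have "\<tau> (\<pi> j) < \<tau> (\<pi> i)" using range[of i] range[of j] by (intro dec) auto
      then show "sconst (0::nat) !! i < sconst 0 !! j \<or>
        sconst (0::nat) !! i = sconst 0 !! j \<and> \<pi> (Suc j) < \<pi> (Suc i)"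
        by (simp add: step)
    qed
    then have "n dvd 2"
      by (rule compatible_even_period[OF assms(3) n]) simp_all
    then have "n \<le> 2" by (rule dvd_imp_le) simp
    then show False using assms(1) by simp
  qed
  ultimately have asc: "ascents n \<tau> = {z}" by blast
  show ?thesis
  proof (rule that)
    show "\<tau> \<in> one_ascent_cycles n" using perm cyc asc by (simp add: one_ascent_cycles_def)
    show "\<pi> = (\<lambda>i. (\<tau> ^^ i) (\<pi> 0))" using iter by simp
    show "s = itinerary n \<tau> (\<pi> 0)"
    proof (rule stream_eq_snthI)
      fix i
      have "s !! i = 0 \<or> s !! i = 1" using bin[of i] by linarith
      then show "s !! i = itinerary n \<tau> (\<pi> 0) !! i"
        using zero_iff[of i] by (auto simp: itinerary_def asc iter)
    qed
  qed
qed

text \<open>The trajectory of \<open>x\<close> visits every point of \<open>{1..n}\<close> and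
  records its successor.\<close>

lemma one_ascent_cycles_eqI:
  assumes "\<tau> \<in> one_ascent_cycles n" "\<tau>' \<in> one_ascent_cycles n" "x \<in> {1..n}"
    and "(\<lambda>i. (\<tau> ^^ i) x) = (\<lambda>i. (\<tau>' ^^ i) x)"
  shows "\<tau> = \<tau>'"
proof
  fix y
  have eq: "(\<tau> ^^ i) x = (\<tau>' ^^ i) x" for i using assms(4) by (rule fun_cong)
  show "\<tau> y = \<tau>' y"
  proof (cases "y \<in> {1..n}")
    case True
    then obtain i where "(\<tau> ^^ i) x = y"
      by (rule ranking_surj[OF itinerary_compatible(2)[OF assms(1,3)]])
    then show ?thesis using eq[of i] eq[of "Suc i"] by simp
  next
    case False
    have "\<tau> permutes {1..n}" "\<tau>' permutes {1..n}"
      using assms(1,2) by (simp_all add: one_ascent_cycles_def)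
    then show ?thesis using False by (simp add: permutes_not_in)
  qed
qed

text \<open>The ranking determines the cycle, and the cycle with its starting point
  \<open>\<pi> 0\<close> determines the itinerary.\<close>

lemma compatible_stream_unique:
  assumes "n \<ge> 3" "ranking n \<pi>"
    and "s \<in> periodic_streams 2 n" "compatible \<pi> s" "t \<in> periodic_streams 2 n" "compatible \<pi> t"
  shows "s = t"
proof -
  obtain \<tau> where \<tau>: "\<tau> \<in> one_ascent_cycles n" "\<pi> = (\<lambda>i. (\<tau> ^^ i) (\<pi> 0))" "s = itinerary n \<tau> (\<pi> 0)"
    by (rule compatible_imp_itinerary[OF assms(1,3,2,4)])
  obtain \<tau>' where \<tau>': "\<tau>' \<in> one_ascent_cycles n" "\<pi> = (\<lambda>i. (\<tau>' ^^ i) (\<pi> 0))" "t = itinerary n \<tau>' (\<pi> 0)"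
    by (rule compatible_imp_itinerary[OF assms(1,5,2,6)])
  have "\<pi> 0 \<in> {1..n}" using ranking_in_range[OF assms(2)] assms(1) by simp
  then have "\<tau> = \<tau>'" using one_ascent_cycles_eqI[OF \<tau>(1) \<tau>'(1)] \<tau>(2) \<tau>'(2) by metis
  then show ?thesis using \<tau>(3) \<tau>'(3) by simp
qed

text \<open>A cycle with a starting point corresponds to a ranking with a compatible stream, so
  \<open>card_compatible_pairs\<close> counts both; the factor \<open>n\<close> comes from the
  starting points.\<close>

lemma mult_num_cyclic_ascents:
  assumes "n \<ge> 3"
  shows "n * num_cyclic_ascents n 2 = card (primitive_streams 2 n)
      + (if n mod 4 = 2 then 2 * card (primitive_streams 2 (n div 2)) else 0)"
proof -
  define h where "h = (\<lambda>(\<tau>, x). (\<lambda>i. (\<tau> ^^ i) x, itinerary n \<tau> x))"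
  let ?C = "{(\<pi>, s). s \<in> periodic_streams 2 n \<and> ranking n \<pi> \<and> compatible \<pi> s}"
  have "inj_on h (one_ascent_cycles n \<times> {1..n})"
  proof (rule inj_onI, clarify)
    fix \<tau> x \<tau>' x'
    assume *: "\<tau> \<in> one_ascent_cycles n" "\<tau>' \<in> one_ascent_cycles n" "x \<in> {1..n}" "h (\<tau>, x) = h (\<tau>', x')"
    then have eq: "(\<lambda>i. (\<tau> ^^ i) x) = (\<lambda>i. (\<tau>' ^^ i) x')" by (simp add: h_def)
    from fun_cong[OF this, of 0] have "x = x'" by simp
    with one_ascent_cycles_eqI[OF *(1-3)] eq show "\<tau> = \<tau>' \<and> x = x'" by simp
  qed
  moreover have "h ` (one_ascent_cycles n \<times> {1..n}) = ?C"
  proof (intro equalityI subsetI)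
    fix c assume "c \<in> h ` (one_ascent_cycles n \<times> {1..n})"
    then show "c \<in> ?C" using itinerary_compatible by (auto simp: h_def)
  next
    fix c assume "c \<in> ?C"
    then obtain \<pi> s where c: "c = (\<pi>, s)" "s \<in> periodic_streams 2 n" "ranking n \<pi>" "compatible \<pi> s"
      by blast
    obtain \<tau> where \<tau>: "\<tau> \<in> one_ascent_cycles n" "\<pi> = (\<lambda>i. (\<tau> ^^ i) (\<pi> 0))" "s = itinerary n \<tau> (\<pi> 0)"
      by (rule compatible_imp_itinerary[OF assms c(2-4)])
    have "\<pi> 0 \<in> {1..n}" using ranking_in_range[OF c(3)] assms by simp
    moreover have "c = h (\<tau>, \<pi> 0)" unfolding c(1) h_def prod.case using \<tau>(2,3) by blast
    ultimately show "c \<in> h ` (one_ascent_cycles n \<times> {1..n})" using \<tau>(1) by blast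
  qed
  ultimately have "bij_betw h (one_ascent_cycles n \<times> {1..n}) ?C" by (rule bij_betw_imageI)
  then have "card ?C = card (one_ascent_cycles n \<times> {1..n})"
    by (rule bij_betw_same_card[symmetric])
  also have "\<dots> = n * num_cyclic_ascents n 2"
    by (simp add: card_cartesian_product num_cyclic_ascents_def one_ascent_cycles_def)
  finally show ?thesis using card_compatible_pairs[of n 2] assms by simp
qed

section \<open>Pattern permutations and the final count\<close>

lemma pattern_perm_eq:
  assumes s: "s \<in> primitive_streams k n" and \<pi>: "ranking n \<pi>" "compatible \<pi> s"
  shows "pattern_perm (reverse_shift k) n s = (\<lambda>i. if i \<in> {1..n} then \<pi> (i - 1) else i)"
    (is "_ = ?\<rho>")
proof -
  have n: "n > 0" "sdrop n s = s" and "sset s \<subseteq> {..<k}"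
    using s by (simp_all add: primitive_streams_def periodic_streams_def)
  then have "sset (sdrop i s) \<subseteq> {..<k}" for i
    by (auto simp: sset_range sdrop_snth)
  then have wl: "word_less (reverse_shift k) (sdrop i s) (sdrop j s) \<longleftrightarrow> \<pi> i < \<pi> j" for i j
  proof (cases "sdrop i s = sdrop j s")
    case True
    then have "\<pi> i = \<pi> j"
      using primitive_streams_sdrop_eq_iff[OF s] ranking_eq_iff[OF \<pi>(1) n(1)] by simp
    then show ?thesis
      using True \<open>\<And>i. sset (sdrop i s) \<subseteq> {..<k}\<close> by (simp add: word_less_reverse_shift not_alt_less_refl)
  next
    case False
    then show ?thesis
      using compatible_less_iff[OF \<pi>(1) n(1) \<pi>(2) n(2) False] \<open>\<And>i. sset (sdrop i s) \<subseteq> {..<k}\<close>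
      by (simp add: word_less_reverse_shift)
  qed
  show ?thesis
    unfolding pattern_perm_def wl
  proof (rule the_equality)
    have "?\<rho> ` {1..n} = \<pi> ` {..<n}"
    proof -
      have "{1..n} = Suc ` {..<n}" by (simp add: image_Suc_lessThan)
      then show ?thesis by (force simp: image_iff)
    qed
    then have img: "?\<rho> ` {1..n} = {1..n}" using \<pi>(1) by (simp add: ranking_def bij_betw_def)
    have "?\<rho> permutes {1..n}"
    proof (rule bij_imp_permutes)
      show "bij_betw ?\<rho> {1..n} {1..n}"
        unfolding bij_betw_def using img eq_card_imp_inj_on[of "{1..n}" ?\<rho>] by simp
    qed auto
    then show "?\<rho> permutes {1..n} \<and> (\<forall>i\<in>{1..n}. \<forall>j\<in>{1..n}. ?\<rho> i < ?\<rho> j \<longleftrightarrow> \<pi> (i - 1) < \<pi> (j - 1))"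
      by simp
  next
    fix \<rho>
    assume \<rho>: "\<rho> permutes {1..n} \<and> (\<forall>i\<in>{1..n}. \<forall>j\<in>{1..n}. \<rho> i < \<rho> j \<longleftrightarrow> \<pi> (i - 1) < \<pi> (j - 1))"
    \<comment> \<open>Renumbering positions from 0 and repeating modulo \<open>n\<close> turns
      \<open>\<rho>\<close> into a ranking, so that \<open>ranking_unique\<close> can compare it
      with \<open>\<pi>\<close>.\<close>
    define \<rho>' where "\<rho>' i = \<rho> (Suc (i mod n))" for i
    have "bij_betw \<rho>' {..<n} {1..n}"
    proof -
      have "bij_betw (\<rho> \<circ> Suc) {..<n} {1..n}"
      proof (rule bij_betw_trans)
        show "bij_betw Suc {..<n} {1..n}" by (simp add: bij_betw_def image_Suc_lessThan)
        show "bij_betw \<rho> {1..n} {1..n}" using \<rho> by (simp add: permutes_imp_bij)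
      qed
      then show ?thesis by (rule bij_betw_cong[THEN iffD1, rotated]) (simp add: \<rho>'_def)
    qed
    then have rank': "ranking n \<rho>'" by (simp add: ranking_def \<rho>'_def)
    have "\<rho>' = \<pi>"
    proof (rule ranking_unique[OF rank' \<pi>(1) n(1)])
      fix i j
      have "Suc (i mod n) \<in> {1..n}" "Suc (j mod n) \<in> {1..n}"
        using n(1) by (simp_all add: Suc_leI)
      then have "\<rho>' i < \<rho>' j \<longleftrightarrow> \<pi> (i mod n) < \<pi> (j mod n)"
        using \<rho> unfolding \<rho>'_def by (metis diff_Suc_1)
      then show "\<rho>' i < \<rho>' j \<longleftrightarrow> \<pi> i < \<pi> j" by (simp add: ranking_mod[OF \<pi>(1)])
    qed
    show "\<rho> = ?\<rho>"
    proof
      fix i show "\<rho> i = ?\<rho> i"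
      proof (cases "i \<in> {1..n}")
        case True
        then have "Suc ((i - 1) mod n) = i" by auto
        then have "\<rho> i = \<rho>' (i - 1)" by (simp only: \<rho>'_def)
        then show ?thesis using True \<open>\<rho>' = \<pi>\<close> by simp
      next
        case False
        then show ?thesis using \<rho> by (auto simp: permutes_not_in)
      qed
    qed
  qed
qed

text \<open>The pattern gives back the ranking, and the ranking gives back the stream, so distinct
  primitive streams have distinct patterns.\<close>

lemma card_periodic_patterns:
  assumes "n \<ge> 3"
  shows "card (periodic_patterns (reverse_shift 2) n) = card (primitive_streams 2 n)"
proof -
  have n: "n > 0" using assms by simp
  have "inj_on (pattern_perm (reverse_shift 2) n) (primitive_streams 2 n)"
  proof (rule inj_onI)
    fix s t assume st: "s \<in> primitive_streams 2 n" "t \<in> primitive_streams 2 n"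
      and eq: "pattern_perm (reverse_shift 2) n s = pattern_perm (reverse_shift 2) n t"
    obtain \<pi> where \<pi>: "ranking n \<pi>" "compatible \<pi> s"
      by (rule compatible_exists[OF st(1), of n]) auto
    obtain \<rho> where \<rho>: "ranking n \<rho>" "compatible \<rho> t"
      by (rule compatible_exists[OF st(2), of n]) auto
    have "\<pi> i = \<rho> i" for i
    proof -
      have "Suc (i mod n) \<in> {1..n}" using n by (simp add: Suc_leI)
      then have "\<pi> (i mod n) = \<rho> (i mod n)"
        using fun_cong[OF eq, of "Suc (i mod n)"]
        by (simp only: pattern_perm_eq[OF st(1) \<pi>] pattern_perm_eq[OF st(2) \<rho>] if_True diff_Suc_1)
      then show ?thesis by (simp add: ranking_mod[OF \<pi>(1)] ranking_mod[OF \<rho>(1)])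
    qed
    then have "\<pi> = \<rho>" by (rule ext)
    then show "s = t"
      using compatible_stream_unique[OF assms \<pi>(1) _ \<pi>(2)] st \<rho>(2)
      by (simp add: primitive_streams_def)
  qed
  then show ?thesis
    unfolding periodic_patterns_def
    by (simp add: reverse_shift_def[of 2] card_image periodic_words_eq_primitive_streams[OF n])
qed

theorem theorem3p14:
  fixes n :: nat
  assumes "n \<ge> 3" and "n mod 4 = 2"
  shows "num_periodic_patterns (reverse_shift 2) n
           = real (num_cyclic_ascents n 2) - real (num_cyclic_ascents (n div 2) 2)
       \<and> real (num_cyclic_ascents n 2) - real (num_cyclic_ascents (n div 2) 2) = L_count 2 n"
proof -
  define p where "p = n div 2"
  \<comment> \<open>The assumptions force \<open>n \<ge> 6\<close>, so the count applies to
    \<open>p\<close> as well. As \<open>p\<close> is odd, its correction term is zero.\<close>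
  have p: "n = 2 * p" "p \<ge> 3" "p mod 4 \<noteq> 2" using assms unfolding p_def by presburger+
  have "n * num_cyclic_ascents n 2 = card (primitive_streams 2 n) + 2 * card (primitive_streams 2 p)"
    using mult_num_cyclic_ascents[OF assms(1)] assms(2) by (simp add: p_def)
  also have "card (primitive_streams 2 p) = p * num_cyclic_ascents p 2"
    using mult_num_cyclic_ascents[OF p(2)] p(3) by simp
  finally have "n * num_cyclic_ascents n 2 = card (primitive_streams 2 n) + n * num_cyclic_ascents p 2"
    using p(1) by simp
  then have "real n * (real (num_cyclic_ascents n 2) - real (num_cyclic_ascents p 2))
      = real (card (primitive_streams 2 n))"
    by (simp add: right_diff_distrib flip: of_nat_mult)
  then have "real (num_cyclic_ascents n 2) - real (num_cyclic_ascents p 2)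
      = real (card (primitive_streams 2 n)) / real n"
    using assms(1) by (simp add: field_simps)
  moreover have "L_count 2 n = real (card (primitive_streams 2 n)) / real n"
    using card_primitive_streams[of n 2] assms(1) by simp
  ultimately show ?thesis
    using card_periodic_patterns[OF assms(1)] by (simp add: num_periodic_patterns_def p_def)
qed

end
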